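(* Let $\mathcal{L}\subset\mathbb{S}^3$ be a net of conics of type $D$, $F$, $F^*$ or $G^*$. Then the reciprocal surface $\mathbb{P}\mathcal{L}^{-1}\subset\mathbb{P}^5$ has degree $2$ and is a projection of the Veronese surface from a line. For types $D$ and $F$, the center of projection is a secant line to the Veronese surface (spanned by two distinct points on it). For types $F^*$ and $G^*$, the center of projection is a tangent line to the Veronese surface.
   Context: Everything is over $\mathbb{C}$. $\mathbb{S}^3$ is the $6$-dimensional space of complex symmetric $3\times 3$ matrices, $\mathbb{P}^5=\mathbb{P}\mathbb{S}^3$. A net of conics is a $3$-dimensional linear subspace of $\mathbb{S}^3$. The reciprocal surface $\mathbb{P}\mathcal{L}^{-1}\subset\mathbb{P}^5$ of a net $\mathcal{L}$ containing an invertible matrix is the Zariski closure of $\mathbb{P}(\{A^{-1} \mid A\in\mathcal{L},\ \det A\neq 0\})$. A symmetric matrix $M$ is identified with the quadratic form $(x,y,z)M(x,y,z)^T$; e.g. $2xz$ is the matrix with entries $1$ at positions $(1,3),(3,1)$ and $0$ elsewhere. Two nets are congruent if $\mathcal{L}_2=g^T\mathcal{L}_1 g$ for some $g\in \mathrm{GL}(3,\mathbb{C})$. A net is of a given type if it is congruent to the net spanned by the following generators. $D$: $x^2,\ y^2,\ z^2+2xy$. $F$: $x^2,\ y^2,\ 2xz+2yz$. $F^*$: $x^2,\ 2xy,\ y^2+z^2$. $G^*$: $x^2,\ 2xy,\ 2yz$. The Veronese surface $V\subset\mathbb{P}^5$ is the image of $\nu:\mathbb{P}^2\to\mathbb{P}\mathbb{S}^3$,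 $v\mapsto vv^T$. A surface in $\mathbb{P}^5$ is a projection of $V$ from a linear subspace $E\subset\mathbb{P}^5$ (the center) if it is the Zariski closure of the image of $V\setminus E$ under a rational map $\mathbb{P}^5\dashrightarrow\mathbb{P}^5$ induced by a linear map $\mathbb{C}^6\to\mathbb{C}^6$ whose kernel has projectivization $E$. *)

theory Defs
  imports "HOL-Analysis.Analysis"
begin

section \<open>Complex symmetric matrices\<close>

definition cscale :: "complex \<Rightarrow> complex^3^3 \<Rightarrow> complex^3^3" where
  "cscale c M = (\<chi> i j. c * M $ i $ j)"

text \<open>The vector space structure of the library on \<^typ>\<open>complex^3^3\<close> is only the real one.\<close>

interpretation cmat: vector_space cscale
  by unfold_locales (simp_all add: cscale_def vec_eq_iff algebra_simps)

definition Sym3 :: "(complex^3^3) set" where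
  "Sym3 = {M. transpose M = M}"

text \<open>The matrix of the quadratic form
  \<open>a x\<^sup>2 + b y\<^sup>2 + c z\<^sup>2 + 2 d xy + 2 e xz + 2 f yz\<close>.\<close>

definition conic ::
    "complex \<Rightarrow> complex \<Rightarrow> complex \<Rightarrow> complex \<Rightarrow> complex \<Rightarrow> complex \<Rightarrow> complex^3^3" where
  "conic a b c d e f = vector [vector [a, d, e], vector [d, b, f], vector [e, f, c]]"

lemma conic_quadratic_form:
  fixes v :: "complex^3"
  shows "(\<Sum>i\<in>UNIV. \<Sum>j\<in>UNIV. v $ i * conic a b c d e f $ i $ j * v $ j) =
    a * (v$1)\<^sup>2 + b * (v$2)\<^sup>2 + c * (v$3)\<^sup>2
      + 2 * d * (v$1 * v$2) + 2 * e * (v$1 * v$3) + 2 * f * (v$2 * v$3)"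
  by (simp add: conic_def sum_3 power2_eq_square algebra_simps)

section \<open>Nets of conics and their types\<close>

definition is_net :: "(complex^3^3) set \<Rightarrow> bool" where
  "is_net L \<longleftrightarrow> cmat.subspace L \<and> L \<subseteq> Sym3 \<and> cmat.dim L = 3"

definition congruent_nets :: "(complex^3^3) set \<Rightarrow> (complex^3^3) set \<Rightarrow> bool" where
  "congruent_nets L1 L2 \<longleftrightarrow>
     (\<exists>g. invertible g \<and> L2 = (\<lambda>A. transpose g ** A ** g) ` L1)"

definition net_D :: "(complex^3^3) set" where
  "net_D = cmat.span {conic 1 0 0 0 0 0, conic 0 1 0 0 0 0, conic 0 0 1 1 0 0}"

definition net_F :: "(complex^3^3) set" where
  "net_F = cmat.span {conic 1 0 0 0 0 0, conic 0 1 0 0 0 0, conic 0 0 0 0 1 1}"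

definition net_Fstar :: "(complex^3^3) set" where
  "net_Fstar = cmat.span {conic 1 0 0 0 0 0, conic 0 0 0 1 0 0, conic 0 1 1 0 0 0}"

definition net_Gstar :: "(complex^3^3) set" where
  "net_Gstar = cmat.span {conic 1 0 0 0 0 0, conic 0 0 0 1 0 0, conic 0 0 0 0 0 1}"

section \<open>Projective geometry in the projective space of symmetric matrices\<close>

text \<open>A point of projective space is a one-dimensional linear subspace, represented as a set
  of matrices, and a subset of projective space is a set of such points.\<close>

definition proj_point :: "complex^3^3 \<Rightarrow> (complex^3^3) set" where
  "proj_point M = cmat.span {M}"

definition Proj :: "(complex^3^3) set \<Rightarrow> (complex^3^3) set set" where
  "Proj S = proj_point ` (S - {0})"

abbreviation P5 :: "(complex^3^3) set set" where
  "P5 \<equiv> Proj Sym3"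

inductive_set poly_functions :: "('a \<Rightarrow> complex) set \<Rightarrow> ('a \<Rightarrow> complex) set"
  for C :: "('a \<Rightarrow> complex) set" where
  const: "(\<lambda>_. c) \<in> poly_functions C"
| coord: "x \<in> C \<Longrightarrow> x \<in> poly_functions C"
| add: "f \<in> poly_functions C \<Longrightarrow> g \<in> poly_functions C \<Longrightarrow> (\<lambda>a. f a + g a) \<in> poly_functions C"
| mult: "f \<in> poly_functions C \<Longrightarrow> g \<in> poly_functions C \<Longrightarrow> (\<lambda>a. f a * g a) \<in> poly_functions C"

definition homogeneous_polys :: "nat \<Rightarrow> (complex^3^3 \<Rightarrow> complex) set" where
  "homogeneous_polys d =
     {f \<in> poly_functions {\<lambda>M. M $ i $ j |i j. True}. \<forall>c M. f (cscale c M) = c ^ d * f M}"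

definition vanishes_on :: "(complex^3^3 \<Rightarrow> complex) \<Rightarrow> (complex^3^3) set set \<Rightarrow> bool" where
  "vanishes_on f X \<longleftrightarrow> (\<forall>p\<in>X. \<forall>M\<in>p. f M = 0)"

definition zariski_closure :: "(complex^3^3) set set \<Rightarrow> (complex^3^3) set set" where
  "zariski_closure X =
     {p \<in> P5. \<forall>d. \<forall>f\<in>homogeneous_polys d. vanishes_on f X \<longrightarrow> vanishes_on f {p}}"

definition reciprocal_surface :: "(complex^3^3) set \<Rightarrow> (complex^3^3) set set" where
  "reciprocal_surface L = zariski_closure (Proj {matrix_inv A |A. A \<in> L \<and> det A \<noteq> 0})"

text \<open>The linear forms on symmetric matrices are exactly the maps \<open>linear_form B\<close> with \<open>B\<close>
  symmetric, so that pairs \<open>(B1, B2)\<close> of symmetric matrices parametrise the linear sections of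
  codimension two.\<close>

definition linear_form :: "complex^3^3 \<Rightarrow> complex^3^3 \<Rightarrow> complex" where
  "linear_form B M = (\<Sum>i\<in>UNIV. \<Sum>j\<in>UNIV. B $ i $ j * M $ i $ j)"

definition pair_polys :: "((complex^3^3) \<times> (complex^3^3) \<Rightarrow> complex) set" where
  "pair_polys =
     poly_functions ({\<lambda>(B1, B2). B1 $ i $ j |i j. True} \<union> {\<lambda>(B1, B2). B2 $ i $ j |i j. True})"

text \<open>The degree of a projective surface is the number of its points on a general linear
  subspace of codimension two, where general means outside the zero locus of some polynomial
  \<open>q\<close> that is not identically zero. For \<open>d > 0\<close> the condition forces a closed set
  \<open>X\<close> to have dimension two, since a general such section is empty in smaller dimension and
  infinite in larger dimension.\<close>

definition surface_degree :: "(complex^3^3) set set \<Rightarrow> nat \<Rightarrow> bool" where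
  "surface_degree X d \<longleftrightarrow>
     (\<exists>q\<in>pair_polys.
        (\<exists>B1\<in>Sym3. \<exists>B2\<in>Sym3. q (B1, B2) \<noteq> 0) \<and>
        (\<forall>B1\<in>Sym3. \<forall>B2\<in>Sym3. q (B1, B2) \<noteq> 0 \<longrightarrow>
           (let S = {p \<in> X. vanishes_on (linear_form B1) {p} \<and> vanishes_on (linear_form B2) {p}}
            in finite S \<and> card S = d)))"

section \<open>The Veronese surface and its projections\<close>

definition veronese_map :: "complex^3 \<Rightarrow> complex^3^3" where
  "veronese_map v = (\<chi> i j. v $ i * v $ j)"

definition Veronese :: "(complex^3^3) set set" where
  "Veronese = {proj_point (veronese_map v) |v. v \<noteq> 0}"

definition proj_line :: "(complex^3^3) set set \<Rightarrow> bool" where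
  "proj_line E \<longleftrightarrow> (\<exists>W. cmat.subspace W \<and> W \<subseteq> Sym3 \<and> cmat.dim W = 2 \<and> E = Proj W)"

text \<open>The rational map induced by \<open>T\<close> sends a point \<open>p\<close> outside \<open>E\<close>, itself a
  one-dimensional subspace, to its image \<open>T ` p\<close>.\<close>

definition projection_of_Veronese_from ::
    "(complex^3^3) set set \<Rightarrow> (complex^3^3) set set \<Rightarrow> bool" where
  "projection_of_Veronese_from X E \<longleftrightarrow>
     (\<exists>T. Vector_Spaces.linear cscale cscale T \<and> T ` Sym3 \<subseteq> Sym3 \<and>
          Proj {M \<in> Sym3. T M = 0} = E \<and>
          X = zariski_closure ((\<lambda>p. T ` p) ` (Veronese - E)))"

definition secant_line :: "(complex^3^3) set set \<Rightarrow> (complex^3^3) set set \<Rightarrow> bool" where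
  "secant_line X E \<longleftrightarrow>
     (\<exists>p\<in>X. \<exists>q\<in>X. p \<noteq> q \<and> E = Proj (cmat.span (p \<union> q)))"

text \<open>The embedded projective tangent space of \<open>X\<close> at \<open>p\<close> is cut out by the differentials,
  at a representative of \<open>p\<close>, of all homogeneous polynomials vanishing on \<open>X\<close>.\<close>

definition tangent_space ::
    "(complex^3^3) set set \<Rightarrow> (complex^3^3) set \<Rightarrow> (complex^3^3) set set" where
  "tangent_space X p =
     Proj {M \<in> Sym3. \<forall>d. \<forall>f\<in>homogeneous_polys d. vanishes_on f X \<longrightarrow>
       (\<forall>A\<in>p - {0}. ((\<lambda>t. f (A + cscale t M)) has_field_derivative 0) (at 0))}"

definition tangent_line :: "(complex^3^3) set set \<Rightarrow> (complex^3^3) set set \<Rightarrow> bool" where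
  "tangent_line X E \<longleftrightarrow> proj_line E \<and> (\<exists>p\<in>X. p \<in> E \<and> E \<subseteq> tangent_space X p)"

end

theory Submission
  imports Defs
begin

text \<open>For a matrix \<open>A(a,b,c)\<close> of any of the four nets, the entries of the adjugate span only a
  four-dimensional space of quadrics in \<open>a, b, c\<close>: it is spanned by \<open>ac, bc, c\<^sup>2, ab\<close> for
  types \<open>D\<close> and \<open>F\<close>, and by \<open>ac, bc, c\<^sup>2, b\<^sup>2\<close> for types \<open>F\<^sup>*\<close> and
  \<open>G\<^sup>*\<close>. Hence the reciprocal surface is the image of the Veronese surface under the linear
  map forgetting the two missing monomials, \<open>a\<^sup>2, b\<^sup>2\<close> respectively \<open>a\<^sup>2, ab\<close>, whose center
  is a secant respectively tangent line. With coordinates \<open>x\<^sub>1, \<dots>, x\<^sub>4\<close> for the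
  four monomials, the image is dense in the quadric \<open>x\<^sub>1 x\<^sub>2 = x\<^sub>3 x\<^sub>4\<close>
  respectively \<open>x\<^sub>2\<^sup>2 = x\<^sub>3 x\<^sub>4\<close>, and a general line meets a quadric in two points.
  Congruence of nets acts on the inverses by a linear isomorphism and does not affect this.\<close>

section \<open>Matrices and points\<close>

lemma cscale_nth [simp]: "cscale c M $ i $ j = c * M $ i $ j"
  by (simp add: cscale_def)

lemma matrix_eq_iff_3: "A = B \<longleftrightarrow> (\<forall>i j. A $ i $ j = B $ i $ j)" for A B :: "complex^3^3"
  by (simp add: vec_eq_iff)

lemma proj_point_eq_range: "proj_point M = range (\<lambda>c. cscale c M)"
  by (simp add: proj_point_def cmat.span_singleton)

lemma self_in_proj_point [simp]: "M \<in> proj_point M"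
  by (simp add: proj_point_def cmat.span_base)

lemma proj_point_cscale:
  assumes "c \<noteq> 0"
  shows "proj_point (cscale c M) = proj_point M"
proof -
  have "cscale d M = cscale (d / c) (cscale c M)" for d
    using assms by simp
  then show ?thesis
    unfolding proj_point_eq_range cmat.scale_scale by blast
qed

lemma proj_point_eqD: "proj_point M = proj_point M' \<Longrightarrow> \<exists>c. M = cscale c M'"
  by (metis self_in_proj_point proj_point_eq_range rangeE)

text \<open>A one-sided inverse of a square matrix is two-sided, also up to a nonzero scalar. This
  lets adjugates stand in for inverses projectively.\<close>

lemma matrix_inv_of_scalar_product:
  assumes "A ** B = cscale d (mat 1)" "d \<noteq> 0"
  shows "matrix_inv A = cscale (1 / d) B"
proof -
  have sc: "A ** cscale c X = cscale c (A ** X)" for c X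
    by (simp add: matrix_eq_iff_3 matrix_matrix_mult_def sum_distrib_left mult_ac)
  have 1: "A ** cscale (1 / d) B = mat 1"
    using assms by (simp add: sc)
  then have 2: "cscale (1 / d) B ** A = mat 1"
    by (simp add: matrix_left_right_inverse)
  have "A ** matrix_inv A = mat 1 \<and> matrix_inv A ** A = mat 1"
    unfolding matrix_inv_def using 1 2 by (intro someI) auto
  then show ?thesis
    by (metis 2 matrix_mul_assoc matrix_mul_lid matrix_mul_rid)
qed

text \<open>Along the pencil the determinant is a cubic polynomial in t with leading coefficient
  \<open>det B\<close>, so it has only finitely many zeros.\<close>

lemma eventually_det_pencil_nonzero:
  fixes A B :: "complex^3^3"
  assumes "det B \<noteq> 0"
  shows "\<forall>\<^sub>F t in at 0. det (A + cscale t B) \<noteq> 0"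
proof -
  define a where "a i j = A $ i $ j" for i j
  define b where "b i j = B $ i $ j" for i j
  define l where "l i j = [:a i j, b i j:]" for i j
  define p where "p = l 1 1 * l 2 2 * l 3 3 + l 1 2 * l 2 3 * l 3 1 + l 1 3 * l 2 1 * l 3 2
     - l 1 1 * l 2 3 * l 3 2 - l 1 2 * l 2 1 * l 3 3 - l 1 3 * l 2 2 * l 3 1"
  have p: "poly p t = det (A + cscale t B)" for t
    by (simp add: p_def l_def a_def b_def det_3 algebra_simps)
  have "coeff p 3 = det B"
    by (simp add: p_def l_def a_def b_def det_3 numeral_3_eq_3 algebra_simps)
  with assms have "p \<noteq> 0" by auto
  then have "finite {t. poly p t = 0}" by (rule poly_roots_finite)
  \<comment> \<open>The root 0 is taken out because \<open>A\<close> itself may be singular; the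
    punctured filter ignores it.\<close>
  then have "open (- ({t. poly p t = 0} - {0}))"
    by (intro open_Compl finite_imp_closed) auto
  then have "\<forall>\<^sub>F t in nhds 0. t \<in> - ({t. poly p t = 0} - {0})"
    by (rule eventually_nhds_in_open) auto
  then show ?thesis
    unfolding eventually_at_filter by eventually_elim (auto simp: p)
qed

section \<open>Polynomial functions and Zariski closures\<close>

abbreviation "entry_polys \<equiv> poly_functions {\<lambda>M. M $ i $ j |i j. True} :: (complex^3^3 \<Rightarrow> complex) set"

lemma poly_functions_uminus: "f \<in> poly_functions C \<Longrightarrow> (\<lambda>a. - f a) \<in> poly_functions C"
  using poly_functions.mult[OF poly_functions.const[of "-1"]] by fastforce

lemma poly_functions_diff:
  "f \<in> poly_functions C \<Longrightarrow> g \<in> poly_functions C \<Longrightarrow> (\<lambda>a. f a - g a) \<in> poly_functions C"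
  using poly_functions.add[OF _ poly_functions_uminus] by fastforce

lemma poly_functions_sum:
  assumes "\<And>i. i \<in> I \<Longrightarrow> f i \<in> poly_functions C"
  shows "(\<lambda>a. \<Sum>i\<in>I. f i a) \<in> poly_functions C"
  using assms
  by (induction I rule: infinite_finite_induct) (auto intro: poly_functions.intros)

lemmas poly_functions_intros =
  poly_functions.const poly_functions.add poly_functions.mult
  poly_functions_uminus poly_functions_diff poly_functions_sum

lemma entry_poly: "(\<lambda>M. M $ i $ j) \<in> entry_polys"
  by (rule poly_functions.coord) auto

lemma linear_form_cscale: "linear_form B (cscale c M) = c * linear_form B M"
  by (simp add: linear_form_def sum_distrib_left mult_ac)

lemma linear_form_sum: "linear_form B (\<Sum>k\<in>I. F k) = (\<Sum>k\<in>I. linear_form B (F k))"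
  unfolding linear_form_def
  by (induction I rule: infinite_finite_induct) (simp_all add: algebra_simps sum.distrib)

lemma linear_form_poly: "linear_form B \<in> entry_polys"
proof -
  have "(\<lambda>M. \<Sum>i\<in>UNIV. \<Sum>j\<in>UNIV. B $ i $ j * M $ i $ j) \<in> entry_polys"
    by (intro poly_functions_intros entry_poly)
  then show ?thesis
    by (metis (no_types, lifting) ext linear_form_def)
qed

lemma vanishes_on_linear_form:
  "vanishes_on (linear_form B) {proj_point M} \<longleftrightarrow> linear_form B M = 0"
  by (auto simp: vanishes_on_def proj_point_eq_range linear_form_cscale dest: spec[of _ 1])

lemma entry_poly_isCont:
  assumes "f \<in> entry_polys" "\<And>i j. isCont (\<lambda>t. \<gamma> t $ i $ j) (a :: complex)"
  shows "isCont (\<lambda>t. f (\<gamma> t)) a"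
  using assms(1) by induction (auto intro!: continuous_intros assms(2))

text \<open>Polynomial functions are continuous, so vanishing along a punctured curve extends to its
  limit. This takes the place of density arguments in the Zariski topology.\<close>

lemma entry_poly_zero_limit:
  assumes "f \<in> entry_polys" "\<And>i j. isCont (\<lambda>t. \<gamma> t $ i $ j) (a :: complex)"
    "\<forall>\<^sub>F t in at a. f (\<gamma> t) = 0"
  shows "f (\<gamma> a) = 0"
proof -
  have "((\<lambda>t. f (\<gamma> t)) \<longlongrightarrow> f (\<gamma> a)) (at a)"
    using entry_poly_isCont[OF assms(1,2)] by (simp add: isCont_def)
  moreover have "((\<lambda>t. f (\<gamma> t)) \<longlongrightarrow> 0) (at a)"
    using assms(3) by (rule tendsto_eventually)
  ultimately show ?thesis
    by (rule tendsto_unique[OF trivial_limit_at])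
qed

text \<open>By the sum and product rules, the derivative of a polynomial along a curve depends only
  on position and velocity. A straight line can thus be traded for a curve on the cone over the
  Veronese surface.\<close>

lemma entry_poly_same_jet:
  assumes "f \<in> entry_polys" "\<gamma> a = \<delta> a"
    "\<And>i j. ((\<lambda>t. \<gamma> t $ i $ j) has_field_derivative M $ i $ j) (at (a :: complex))"
    "\<And>i j. ((\<lambda>t. \<delta> t $ i $ j) has_field_derivative M $ i $ j) (at a)"
  shows "\<exists>D. ((\<lambda>t. f (\<gamma> t)) has_field_derivative D) (at a) \<and>
             ((\<lambda>t. f (\<delta> t)) has_field_derivative D) (at a)"
  using assms(1)
proof induction
  case (const c)
  show ?case by (auto intro!: exI[of _ 0])
next
  case (coord x)
  then obtain i j where "x = (\<lambda>M. M $ i $ j)" by blast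
  with assms(3,4)[of i j] show ?case by auto
next
  case (add f g)
  then obtain D E where
    "((\<lambda>t. f (\<gamma> t)) has_field_derivative D) (at a)" "((\<lambda>t. f (\<delta> t)) has_field_derivative D) (at a)"
    "((\<lambda>t. g (\<gamma> t)) has_field_derivative E) (at a)" "((\<lambda>t. g (\<delta> t)) has_field_derivative E) (at a)"
    by blast
  then show ?case
    by (intro exI[of _ "D + E"]) (auto intro: DERIV_add)
next
  case (mult f g)
  then obtain D E where
    "((\<lambda>t. f (\<gamma> t)) has_field_derivative D) (at a)" "((\<lambda>t. f (\<delta> t)) has_field_derivative D) (at a)"
    "((\<lambda>t. g (\<gamma> t)) has_field_derivative E) (at a)" "((\<lambda>t. g (\<delta> t)) has_field_derivative E) (at a)"
    by blast
  then show ?case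
    using DERIV_mult[of "\<lambda>t. f (\<gamma> t)" D a UNIV "\<lambda>t. g (\<gamma> t)" E]
      DERIV_mult[of "\<lambda>t. f (\<delta> t)" D a UNIV "\<lambda>t. g (\<delta> t)" E]
    by (auto simp: assms(2))
qed

lemma homogeneous_polysD:
  assumes "f \<in> homogeneous_polys d"
  shows "f \<in> entry_polys" "f (cscale c M) = c ^ d * f M"
  using assms by (auto simp: homogeneous_polys_def)

lemma vanishes_on_point:
  assumes "f \<in> homogeneous_polys d"
  shows "vanishes_on f {proj_point M} \<longleftrightarrow> f M = 0"
  using homogeneous_polysD(2)[OF assms]
  by (auto simp: vanishes_on_def proj_point_eq_range dest: spec[of _ 1])

section \<open>The Veronese surface and its secant and tangent lines\<close>

abbreviation vec3 :: "complex \<Rightarrow> complex \<Rightarrow> complex \<Rightarrow> complex^3" where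
  "vec3 a b c \<equiv> vector [a, b, c]"

lemma veronese_map_zero_iff: "veronese_map v = 0 \<longleftrightarrow> v = 0"
  by (auto simp: veronese_map_def vec_eq_iff)

lemma veronese_map_Sym3: "veronese_map v \<in> Sym3"
  by (simp add: Sym3_def veronese_map_def transpose_def vec_eq_iff mult.commute)

lemma Sym3_iff: "M \<in> Sym3 \<longleftrightarrow> M $ 2 $ 1 = M $ 1 $ 2 \<and> M $ 3 $ 1 = M $ 1 $ 3 \<and> M $ 3 $ 2 = M $ 2 $ 3"
  by (auto simp: Sym3_def transpose_def vec_eq_iff forall_3)

lemma Sym3_cases:
  assumes "M \<in> Sym3"
  obtains a b c d e f where "M = conic a b c d e f"
  using assms that[of "M$1$1" "M$2$2" "M$3$3" "M$1$2" "M$1$3" "M$2$3"]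
  by (simp add: Sym3_iff conic_def vec_eq_iff forall_3)

lemma conic_nth [simp]:
  "conic a b c d e f $ 1 $ 1 = a" "conic a b c d e f $ 2 $ 2 = b" "conic a b c d e f $ 3 $ 3 = c"
  "conic a b c d e f $ 1 $ 2 = d" "conic a b c d e f $ 2 $ 1 = d"
  "conic a b c d e f $ 1 $ 3 = e" "conic a b c d e f $ 3 $ 1 = e"
  "conic a b c d e f $ 2 $ 3 = f" "conic a b c d e f $ 3 $ 2 = f"
  by (simp_all add: conic_def)

lemma conic_in_Sym3 [simp]: "conic a b c d e f \<in> Sym3"
  by (simp add: Sym3_iff)

lemma conic_eq_iff [simp]:
  "conic a b c d e f = conic a' b' c' d' e' f' \<longleftrightarrow>
     a = a' \<and> b = b' \<and> c = c' \<and> d = d' \<and> e = e' \<and> f = f'"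
  by (auto simp: conic_def vec_eq_iff forall_3)

lemma conic_zero: "0 = conic 0 0 0 0 0 0"
  by (simp add: vec_eq_iff forall_3)

lemma conic_add [simp]: "conic a b c d e f + conic a' b' c' d' e' f' =
    conic (a + a') (b + b') (c + c') (d + d') (e + e') (f + f')"
  by (simp add: vec_eq_iff forall_3)

lemma cscale_conic [simp]: "cscale k (conic a b c d e f) =
    conic (k * a) (k * b) (k * c) (k * d) (k * e) (k * f)"
  by (simp add: vec_eq_iff forall_3)

section \<open>Explicit spans and the center of the projection\<close>

lemma span_pair: "cmat.span {A, B} = {cscale x A + cscale y B |x y. True}"
proof (rule set_eqI)
  fix M
  have "M \<in> cmat.span {A, B} \<longleftrightarrow> (\<exists>x y. M - cscale x A = cscale y B)"
    by (auto simp: cmat.span_breakdown_eq[of M A] cmat.span_singleton)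
  also have "\<dots> \<longleftrightarrow> M \<in> {cscale x A + cscale y B |x y. True}"
    by (simp add: diff_eq_eq add.commute)
  finally show "M \<in> cmat.span {A, B} \<longleftrightarrow> M \<in> {cscale x A + cscale y B |x y. True}" .
qed

lemma span_triple:
  "cmat.span {A, B, C} = {cscale x A + cscale y B + cscale z C |x y z. True}"
proof (rule set_eqI)
  fix M
  have "M \<in> cmat.span {A, B, C} \<longleftrightarrow> (\<exists>x y z. M - cscale x A = cscale y B + cscale z C)"
    by (simp add: cmat.span_breakdown_eq[of M A] span_pair)
  also have "\<dots> \<longleftrightarrow> M \<in> {cscale x A + cscale y B + cscale z C |x y z. True}"
    by (simp add: diff_eq_eq add_ac)
  finally show "M \<in> cmat.span {A, B, C} \<longleftrightarrow>
      M \<in> {cscale x A + cscale y B + cscale z C |x y z. True}" .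
qed

text \<open>The center of the projection: the line through \<open>x\<^sup>2\<close> and \<open>y\<^sup>2\<close>, or the tangent line
  at \<open>x\<^sup>2\<close> in the direction \<open>2xy\<close>.\<close>

definition center_space :: "bool \<Rightarrow> (complex^3^3) set" where
  "center_space sec = cmat.span {conic 1 0 0 0 0 0,
     if sec then conic 0 1 0 0 0 0 else conic 0 0 0 1 0 0}"

lemma center_space_iff:
  "M \<in> center_space sec \<longleftrightarrow>
    M \<in> Sym3 \<and> M$1$3 = 0 \<and> M$2$3 = 0 \<and> M$3$3 = 0 \<and> (if sec then M$1$2 else M$2$2) = 0"
proof
  assume "M \<in> center_space sec"
  then show "M \<in> Sym3 \<and> M$1$3 = 0 \<and> M$2$3 = 0 \<and> M$3$3 = 0 \<and> (if sec then M$1$2 else M$2$2) = 0"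
    by (cases sec) (auto simp: center_space_def span_pair)
next
  assume M: "M \<in> Sym3 \<and> M$1$3 = 0 \<and> M$2$3 = 0 \<and> M$3$3 = 0 \<and> (if sec then M$1$2 else M$2$2) = 0"
  then obtain a b c d e f where "M = conic a b c d e f"
    by (meson Sym3_cases)
  with M show "M \<in> center_space sec"
    by (cases sec) (auto simp: center_space_def span_pair)
qed

lemma proj_line_center: "proj_line (Proj (center_space sec))"
proof -
  let ?a = "conic 1 0 0 0 0 0"
  let ?b = "if sec then conic 0 1 0 0 0 0 else conic 0 0 0 1 0 0"
  have "?a \<noteq> ?b" by simp
  moreover have "cmat.independent {?a, ?b}"
    by (auto simp: cmat.independent_insert cmat.span_singleton conic_zero)
  ultimately have "cmat.dim (center_space sec) = 2"
    unfolding center_space_def by (subst cmat.dim_span_eq_card_independent) auto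
  moreover have "cmat.subspace (center_space sec)"
    by (simp add: center_space_def)
  moreover have "center_space sec \<subseteq> Sym3"
    by (auto simp: center_space_iff)
  ultimately show ?thesis unfolding proj_line_def by blast
qed

lemma veronese_map_vec3:
  "veronese_map (vec3 a b c) = conic (a * a) (b * b) (c * c) (a * b) (a * c) (b * c)"
  by (simp add: veronese_map_def vec_eq_iff forall_3)

lemma conic_square_in_Veronese:
  "proj_point (conic 1 0 0 0 0 0) \<in> Veronese" "proj_point (conic 0 1 0 0 0 0) \<in> Veronese"
proof -
  have *: "veronese_map (vec3 1 0 0) = conic 1 0 0 0 0 0" "veronese_map (vec3 0 1 0) = conic 0 1 0 0 0 0"
    by (simp_all add: veronese_map_vec3)
  then have "vec3 1 0 0 \<noteq> 0" "vec3 0 1 0 \<noteq> 0"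
    by (simp_all add: conic_zero flip: veronese_map_zero_iff)
  with * show "proj_point (conic 1 0 0 0 0 0) \<in> Veronese" "proj_point (conic 0 1 0 0 0 0) \<in> Veronese"
    unfolding Veronese_def by (metis (mono_tags, lifting) mem_Collect_eq)+
qed

lemma secant_line_center: "secant_line Veronese (Proj (center_space True))"
proof -
  let ?p = "proj_point (conic 1 0 0 0 0 0)" and ?q = "proj_point (conic 0 1 0 0 0 0)"
  have "?p \<noteq> ?q"
    by (auto dest: proj_point_eqD)
  moreover have "cmat.span (?p \<union> ?q) = center_space True"
    unfolding center_space_def if_True cmat.span_eq
  proof
    show "?p \<union> ?q \<subseteq> cmat.span {conic 1 0 0 0 0 0, conic 0 1 0 0 0 0}"
      unfolding proj_point_def by (intro Un_least cmat.span_mono) auto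
    have "{conic 1 0 0 0 0 0, conic 0 1 0 0 0 0} \<subseteq> ?p \<union> ?q" by simp
    then show "{conic 1 0 0 0 0 0, conic 0 1 0 0 0 0} \<subseteq> cmat.span (?p \<union> ?q)"
      using cmat.span_superset by blast
  qed
  ultimately show ?thesis
    unfolding secant_line_def using conic_square_in_Veronese by metis
qed

lemma Veronese_vanishing:
  assumes "f \<in> homogeneous_polys d" "vanishes_on f Veronese"
  shows "f (veronese_map v) = 0"
proof (cases "v = 0")
  case True
  \<comment> \<open>A projective point is a whole line through the origin, so it contains the zero
    matrix and \<open>f\<close> vanishes there too.\<close>
  have "veronese_map v = cscale 0 (conic 1 0 0 0 0 0)"
    using True by (simp add: veronese_map_zero_iff del: cscale_conic)
  moreover have "cscale 0 (conic 1 0 0 0 0 0) \<in> proj_point (conic 1 0 0 0 0 0)"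
    by (auto simp: proj_point_eq_range simp del: cmat.scale_zero_left cscale_conic)
  ultimately show ?thesis
    using assms(2) conic_square_in_Veronese(1) unfolding vanishes_on_def by metis
next
  case False
  then have "proj_point (veronese_map v) \<in> Veronese"
    by (auto simp: Veronese_def)
  then show ?thesis
    using assms(2) self_in_proj_point unfolding vanishes_on_def by blast
qed

lemma tangent_line_center: "tangent_line Veronese (Proj (center_space False))"
proof -
  let ?p = "proj_point (conic 1 0 0 0 0 0)"
  have "((\<lambda>t. f (A + cscale t M)) has_field_derivative 0) (at 0)"
    if M: "M \<in> center_space False" and f: "f \<in> homogeneous_polys d" "vanishes_on f Veronese"
      and A: "A \<in> ?p - {0}" for M d f A
  proof -
    obtain x y where M_eq: "M = conic x 0 0 y 0 0"
      using M by (auto simp: center_space_def span_pair)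
    obtain k where A_eq: "A = conic k 0 0 0 0 0" and k: "k \<noteq> 0"
      using A by (auto simp: proj_point_eq_range conic_zero)
    \<comment> \<open>With \<open>m\<close> a square root of \<open>k\<close>, the matrix
      \<open>A\<close> is the Veronese image of (m, 0, 0).\<close>
    define m where "m = csqrt k"
    have m: "m * m = k" "m \<noteq> 0"
      using k by (auto simp: m_def simp flip: power2_eq_square)
    \<comment> \<open>A curve on the cone over the Veronese surface with the same value and velocity
      at \<open>0\<close> as the line \<open>t \<mapsto> A + t M\<close>.\<close>
    define \<delta> where "\<delta> t = veronese_map (vec3 (m + t * x / (2 * m)) (t * y / m) 0)" for t
    obtain D where D: "((\<lambda>t. f (A + cscale t M)) has_field_derivative D) (at 0)"
        "((\<lambda>t. f (\<delta> t)) has_field_derivative D) (at 0)"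
    proof -
      have "A + cscale 0 M = \<delta> 0"
        by (simp add: \<delta>_def veronese_map_vec3 A_eq m)
      moreover have "((\<lambda>t. (A + cscale t M) $ i $ j) has_field_derivative M $ i $ j) (at 0)" for i j
        by (auto intro!: derivative_eq_intros)
      moreover have "((\<lambda>t. \<delta> t $ i $ j) has_field_derivative M $ i $ j) (at 0)" for i j
      proof -
        have "\<forall>i j. ((\<lambda>t. \<delta> t $ i $ j) has_field_derivative M $ i $ j) (at 0)"
          unfolding forall_3 \<delta>_def veronese_map_vec3 M_eq
          using m by (auto intro!: derivative_eq_intros simp: field_simps)
        then show ?thesis by blast
      qed
      ultimately show ?thesis
        using entry_poly_same_jet[OF homogeneous_polysD(1)[OF f(1)], of "\<lambda>t. A + cscale t M" 0 \<delta> M] that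
        by blast
    qed
    \<comment> \<open>The curve stays on the cone, where \<open>f\<close> vanishes, so the common
      derivative \<open>D\<close> is 0.\<close>
    have "(\<lambda>t. f (\<delta> t)) = (\<lambda>t. 0)"
      by (auto simp: \<delta>_def Veronese_vanishing[OF f])
    with D show ?thesis
      using DERIV_unique[of "\<lambda>t. 0" D 0 0] by auto
  qed
  then have "center_space False \<subseteq> {M \<in> Sym3. \<forall>d. \<forall>f\<in>homogeneous_polys d. vanishes_on f Veronese \<longrightarrow>
       (\<forall>A\<in>?p - {0}. ((\<lambda>t. f (A + cscale t M)) has_field_derivative 0) (at 0))}"
    using center_space_iff by blast
  then have "Proj (center_space False) \<subseteq> tangent_space Veronese ?p"
    unfolding tangent_space_def Proj_def by blast
  moreover have "?p \<in> Proj (center_space False)"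
    unfolding Proj_def by (auto simp: center_space_iff conic_zero)
  ultimately show ?thesis
    unfolding tangent_line_def using proj_line_center conic_square_in_Veronese by blast
qed


section \<open>Quadrics parametrised by adjugates\<close>

definition combination :: "(complex^3^3)^4 \<Rightarrow> complex^4 \<Rightarrow> complex^3^3" where
  "combination N x = (\<Sum>k\<in>UNIV. cscale (x $ k) (N $ k))"

text \<open>At the Veronese image of (a, b, c) these are ac, bc, c^2 and ab or b^2. They are linear
  in the matrix, and on symmetric matrices their common zeros form the center.\<close>

definition veronese_coords :: "bool \<Rightarrow> complex^3^3 \<Rightarrow> complex^4" where
  "veronese_coords sec M = vector [M$1$3, M$2$3, M$3$3, if sec then M$1$2 else M$2$2]"

definition on_quadric :: "bool \<Rightarrow> complex^4 \<Rightarrow> bool" where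
  "on_quadric sec x \<longleftrightarrow> (if sec then x$1 else x$2) * x$2 = x$3 * x$4"

lemma vector_4 [simp]:
  "(vector [a, b, c, d] :: ('a::zero)^4) $ 1 = a"
  "(vector [a, b, c, d] :: ('a::zero)^4) $ 2 = b"
  "(vector [a, b, c, d] :: ('a::zero)^4) $ 3 = c"
  "(vector [a, b, c, d] :: ('a::zero)^4) $ 4 = d"
  unfolding vector_def by simp_all

lemma linear_form_combination:
  "linear_form B (combination N x) = (\<Sum>k\<in>UNIV. x $ k * linear_form B (N $ k))"
  by (simp add: combination_def linear_form_sum linear_form_cscale)

lemma combination_nth: "combination N x $ i $ j = (\<Sum>k\<in>UNIV. x $ k * N $ k $ i $ j)"
  by (simp add: combination_def)

lemma combination_scale: "combination N (c *s x) = cscale c (combination N x)"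
  by (simp add: matrix_eq_iff_3 combination_nth sum_distrib_left mult_ac)

lemma combination_add: "combination N (x + y) = combination N x + combination N y"
  by (simp add: matrix_eq_iff_3 combination_nth sum.distrib algebra_simps)

lemma veronese_coords_scale: "veronese_coords sec (cscale c M) = c *s veronese_coords sec M"
  by (simp add: veronese_coords_def vec_eq_iff forall_4)

lemma veronese_coords_add: "veronese_coords sec (M + M') = veronese_coords sec M + veronese_coords sec M'"
  by (simp add: veronese_coords_def vec_eq_iff forall_4)

lemma veronese_coords_veronese:
  "veronese_coords sec (veronese_map v) =
    vector [v$1 * v$3, v$2 * v$3, v$3 * v$3, (if sec then v$1 else v$2) * v$2]"
  by (simp add: veronese_coords_def veronese_map_def)

lemma veronese_coords_zero_iff:
  "M \<in> Sym3 \<Longrightarrow> veronese_coords sec M = 0 \<longleftrightarrow> M \<in> center_space sec"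
  by (simp add: veronese_coords_def vec_eq_iff forall_4 center_space_iff)

section \<open>Points of the quadric as limits of parametrised points\<close>

text \<open>As x3 plays the role of c^2, take c to be a square root of it and divide x1 and x2 by c;
  the equation then determines x4.\<close>

lemma on_quadric_affine:
  assumes "on_quadric sec x" "x $ 3 \<noteq> 0"
  shows "\<exists>v. x = veronese_coords sec (veronese_map v)"
proof -
  define m where "m = csqrt (x $ 3)"
  have m: "m * m = x $ 3" "m \<noteq> 0"
    using assms(2) by (auto simp: m_def simp flip: power2_eq_square)
  have "x $ 4 = (if sec then x$1 else x$2) * x$2 / (m * m)"
    using assms m(1) by (simp add: on_quadric_def field_simps)
  then have "x = veronese_coords sec (veronese_map (vec3 (x$1 / m) (x$2 / m) m))"
    unfolding veronese_coords_veronese using m by (simp add: vec_eq_iff forall_4)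
  then show ?thesis by blast
qed

text \<open>Points with x3 = 0 need not be parametrised, but explicit curves on the quadric exhibit
  each as a limit of points with x3 nonzero.\<close>

lemma on_quadric_perturb:
  assumes "on_quadric sec x"
  obtains \<gamma> where "\<gamma> (0 :: complex) = x" "\<And>k. isCont (\<lambda>t. \<gamma> t $ k) 0"
    "\<And>t. t \<noteq> 0 \<Longrightarrow> on_quadric sec (\<gamma> t) \<and> \<gamma> t $ 3 \<noteq> (0 :: complex)"
proof -
  consider "x $ 3 \<noteq> 0" | "x $ 3 = 0" "\<not> sec" | "x $ 3 = 0" "sec" "x $ 1 \<noteq> 0"
    | "x $ 3 = 0" "sec" "x $ 2 \<noteq> 0" | "x $ 3 = 0" "sec" "x $ 1 = 0" "x $ 2 = 0"
    by blast
  then have "\<exists>\<gamma>. \<gamma> (0 :: complex) = x \<and> (\<forall>k. isCont (\<lambda>t. \<gamma> t $ k) 0) \<and>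
    (\<forall>t. t \<noteq> 0 \<longrightarrow> on_quadric sec (\<gamma> t) \<and> \<gamma> t $ 3 \<noteq> (0 :: complex))"
  proof cases
    case 1
    with assms show ?thesis by (intro exI[of _ "\<lambda>_. x"]) auto
  next
    case 2
    \<comment> \<open>With x3 = t^2 the equation x2^2 = x3 x4 is solved by x2 = t m.\<close>
    define m where "m = csqrt (x $ 4)"
    have m: "m * m = x $ 4" by (simp add: m_def flip: power2_eq_square)
    have "x $ 2 = 0" using assms 2 by (simp add: on_quadric_def)
    with 2 m show ?thesis
      by (intro exI[of _ "\<lambda>t. (vector [x $ 1, t * m, t * t, x $ 4] :: complex^4)"])
         (auto simp add: vec_eq_iff forall_4 on_quadric_def intro!: continuous_intros)
  next
    case 3
    then have "x $ 2 = 0" using assms by (simp add: on_quadric_def)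
    with 3 show ?thesis
      by (intro exI[of _ "\<lambda>t. (vector [x $ 1, t * x $ 4 / x $ 1, t, x $ 4] :: complex^4)"])
         (auto simp add: vec_eq_iff forall_4 on_quadric_def intro!: continuous_intros)
  next
    case 4
    then have "x $ 1 = 0" using assms by (simp add: on_quadric_def)
    with 4 show ?thesis
      by (intro exI[of _ "\<lambda>t. (vector [t * x $ 4 / x $ 2, x $ 2, t, x $ 4] :: complex^4)"])
         (auto simp add: vec_eq_iff forall_4 on_quadric_def intro!: continuous_intros)
  next
    case 5
    \<comment> \<open>Neither x1 nor x2 can be divided by here, so both move: t and t x4 have
      product x3 x4 for x3 = t^2.\<close>
    then show ?thesis
      by (intro exI[of _ "\<lambda>t. (vector [t, t * x $ 4, t * t, x $ 4] :: complex^4)"])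
         (auto simp add: vec_eq_iff forall_4 on_quadric_def intro!: continuous_intros)
  qed
  with that show thesis by blast
qed

text \<open>By Cramer's rule, on the line cut out by two linear forms with coefficients \<open>x\<close> and
  \<open>y\<close> the coordinates \<open>1\<close> and \<open>4\<close> are linear forms in the other two when \<open>d \<noteq> 0\<close>,
  and the equation of the quadric, multiplied by \<open>d\<close>, becomes a binary form with
  coefficients \<open>a\<close>, \<open>b\<close>, \<open>c\<close>.\<close>

definition section_discriminant :: "bool \<Rightarrow> (4 \<Rightarrow> complex) \<Rightarrow> (4 \<Rightarrow> complex) \<Rightarrow> complex" where
  "section_discriminant sec x y =
    (let d = x 1 * y 4 - x 4 * y 1;
         a = (if sec then x 4 * y 2 - x 2 * y 4 else d);
         b = (if sec then x 4 * y 3 - x 3 * y 4 else 0) - (x 2 * y 1 - x 1 * y 2);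
         c = - (x 3 * y 1 - x 1 * y 3)
     in d * a * (b * b - 4 * a * c))"

section \<open>Intersection of the quadric with a general line\<close>

text \<open>The quadratic formula for a binary form; keeping both variables also covers points with
  r = 0.\<close>

lemma binary_quadratic_roots:
  fixes a b c :: complex
  assumes "a \<noteq> 0" "b * b - 4 * a * c \<noteq> 0"
  obtains u v where "u \<noteq> v" "\<And>q r. a * q * q + b * q * r + c * r * r = a * (q - u * r) * (q - v * r)"
proof -
  define s where "s = csqrt (b * b - 4 * a * c)"
  have s: "s * s = b * b - 4 * a * c" by (simp add: s_def flip: power2_eq_square)
  define u v where "u = (- b + s) / (2 * a)" and "v = (- b - s) / (2 * a)"
  have "s \<noteq> 0" using s assms by auto
  then have "u \<noteq> v" using assms by (auto simp: u_def v_def)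
  moreover have "a * q * q + b * q * r + c * r * r = a * (q - u * r) * (q - v * r)" for q r
  proof -
    have 1: "a * u + a * v = - b"
      using assms by (simp add: u_def v_def field_simps)
    have "4 * a * (a * (u * v)) = b * b - s * s"
      using assms by (simp add: u_def v_def field_simps)
    then have 2: "a * (u * v) = c" using assms by (simp add: s)
    have "a * (q - u * r) * (q - v * r) = a * q * q - (a * u + a * v) * q * r + a * (u * v) * r * r"
      by (simp add: algebra_simps)
    then show ?thesis unfolding 1 2 by simp
  qed
  ultimately show thesis by (rule that)
qed

text \<open>A nonzero leading coefficient excludes section points with z3 = 0, so each can be scaled
  to z3 = 1; a nonzero discriminant makes the two roots distinct.\<close>

lemma quadric_line_section:
  assumes "section_discriminant sec x y \<noteq> 0"
  obtains z1 z2 where "z1 $ 3 = 1" "z2 $ 3 = 1" "z1 \<noteq> z2"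
    "\<And>z. z \<noteq> 0 \<and> on_quadric sec z \<and> (\<Sum>k\<in>UNIV. z $ k * x k) = 0 \<and> (\<Sum>k\<in>UNIV. z $ k * y k) = 0
      \<longleftrightarrow> (\<exists>c. c \<noteq> 0 \<and> (z = c *s z1 \<or> z = c *s z2))"
proof -
  define d where "d = x 1 * y 4 - x 4 * y 1"
  \<comment> \<open>Cramer's rule: solutions of the two linear equations satisfy
    \<open>z1 = \<alpha> z2 + \<beta> z3\<close> and
    \<open>z4 = \<gamma> z2 + \<delta> z3\<close>.\<close>
  define \<alpha> \<beta> where "\<alpha> = (x 4 * y 2 - x 2 * y 4) / d" and "\<beta> = (x 4 * y 3 - x 3 * y 4) / d"
  define \<gamma> \<delta> where "\<gamma> = (x 2 * y 1 - x 1 * y 2) / d" and "\<delta> = (x 3 * y 1 - x 1 * y 3) / d"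
  define a where "a = (if sec then \<alpha> else 1)"
  define b where "b = (if sec then \<beta> else 0) - \<gamma>"
  have d: "d \<noteq> 0"
    using assms by (auto simp: section_discriminant_def d_def)
  have D: "d * \<alpha> = x 4 * y 2 - x 2 * y 4" "d * \<beta> = x 4 * y 3 - x 3 * y 4"
    "d * \<gamma> = x 2 * y 1 - x 1 * y 2" "d * \<delta> = x 3 * y 1 - x 1 * y 3"
    using d by (simp_all add: \<alpha>_def \<beta>_def \<gamma>_def \<delta>_def)
  \<comment> \<open>Scaling \<open>a\<close>, \<open>b\<close> and \<open>\<delta>\<close> by
    \<open>d\<close> clears denominators, which makes the condition polynomial in \<open>x\<close>
    and \<open>y\<close>; the cost is the nonzero factor d^4.\<close>
  have "section_discriminant sec x y = d * (d * a) * ((d * b) * (d * b) - 4 * (d * a) * (d * (- \<delta>)))"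
    unfolding section_discriminant_def Let_def d_def[symmetric]
    unfolding a_def b_def right_diff_distrib[of d _ \<gamma>] D mult_minus_right
    by (cases sec) (simp_all only: D if_True if_False mult_zero_right mult_1_right)
  also have "\<dots> = d * d * d * d * (a * (b * b - 4 * a * (- \<delta>)))"
    by (simp add: algebra_simps)
  finally have "a \<noteq> 0" "b * b - 4 * a * (- \<delta>) \<noteq> 0"
    using assms by force+
  then obtain u v where uv: "u \<noteq> v"
    "\<And>q r. a * q * q + b * q * r + (- \<delta>) * r * r = a * (q - u * r) * (q - v * r)"
    using binary_quadratic_roots by blast
  define line where "line q r = (vector [\<alpha> * q + \<beta> * r, q, r, \<gamma> * q + \<delta> * r] :: complex^4)" for q r
  have on_line: "(\<Sum>k\<in>UNIV. z $ k * x k) = 0 \<and> (\<Sum>k\<in>UNIV. z $ k * y k) = 0 \<longleftrightarrow> z = line (z $ 2) (z $ 3)" for z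
  proof
    assume "(\<Sum>k\<in>UNIV. z $ k * x k) = 0 \<and> (\<Sum>k\<in>UNIV. z $ k * y k) = 0"
    then have e: "z $ 1 * x 1 + z $ 2 * x 2 + z $ 3 * x 3 + z $ 4 * x 4 = 0"
        "z $ 1 * y 1 + z $ 2 * y 2 + z $ 3 * y 3 + z $ 4 * y 4 = 0"
      by (simp_all add: sum_4)
    \<comment> \<open>Eliminating z4 from the two equations gives z1, and eliminating z1 gives
      z4.\<close>
    have "d * z $ 1 = d * (\<alpha> * z $ 2 + \<beta> * z $ 3)"
      unfolding distrib_left mult.assoc[symmetric] D unfolding d_def using e by algebra
    moreover have "d * z $ 4 = d * (\<gamma> * z $ 2 + \<delta> * z $ 3)"
      unfolding distrib_left mult.assoc[symmetric] D unfolding d_def using e by algebra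
    ultimately show "z = line (z $ 2) (z $ 3)"
      using d by (simp add: vec_eq_iff forall_4 line_def)
  next
    assume "z = line (z $ 2) (z $ 3)"
    then have z: "z $ 1 = \<alpha> * z $ 2 + \<beta> * z $ 3" "z $ 4 = \<gamma> * z $ 2 + \<delta> * z $ 3"
      by (simp_all add: vec_eq_iff forall_4 line_def)
    have "d * (z $ 1 * w 1 + z $ 2 * w 2 + z $ 3 * w 3 + z $ 4 * w 4) =
       (d * \<alpha> * z $ 2 + d * \<beta> * z $ 3) * w 1 + d * z $ 2 * w 2 + d * z $ 3 * w 3
         + (d * \<gamma> * z $ 2 + d * \<delta> * z $ 3) * w 4" for w :: "4 \<Rightarrow> complex"
      unfolding z by (simp add: algebra_simps)
    from this[of x] this[of y]
    have "d * (z $ 1 * x 1 + z $ 2 * x 2 + z $ 3 * x 3 + z $ 4 * x 4) = 0"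
      "d * (z $ 1 * y 1 + z $ 2 * y 2 + z $ 3 * y 3 + z $ 4 * y 4) = 0"
      unfolding D unfolding d_def by (simp_all add: algebra_simps)
    with d show "(\<Sum>k\<in>UNIV. z $ k * x k) = 0 \<and> (\<Sum>k\<in>UNIV. z $ k * y k) = 0"
      by (simp add: sum_4)
  qed
  have quadric: "on_quadric sec (line q r) \<longleftrightarrow> q = u * r \<or> q = v * r" for q r
  proof -
    have "(if sec then \<alpha> * q + \<beta> * r else q) * q - r * (\<gamma> * q + \<delta> * r) =
        a * q * q + b * q * r + (- \<delta>) * r * r"
      by (cases sec) (simp_all add: a_def b_def algebra_simps)
    then have "on_quadric sec (line q r) \<longleftrightarrow> a * (q - u * r) * (q - v * r) = 0"
      unfolding uv(2) on_quadric_def line_def vector_4 by (metis right_minus_eq)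
    then show ?thesis
      using \<open>a \<noteq> 0\<close> by simp
  qed
  have scale: "line (w * r) r = r *s line w 1" for w r
    by (simp add: line_def vec_eq_iff forall_4 algebra_simps)
  show thesis
  proof (rule that)
    show "line u 1 $ 3 = 1" "line v 1 $ 3 = 1" "line u 1 \<noteq> line v 1"
      using uv(1) by (simp_all add: line_def vec_eq_iff forall_4)
    fix z
    have "z \<noteq> 0 \<and> on_quadric sec z \<and> z = line (z $ 2) (z $ 3)
      \<longleftrightarrow> (\<exists>c. c \<noteq> 0 \<and> (z = c *s line u 1 \<or> z = c *s line v 1))"
    proof
      assume z: "z \<noteq> 0 \<and> on_quadric sec z \<and> z = line (z $ 2) (z $ 3)"
      then have "z $ 2 = u * z $ 3 \<or> z $ 2 = v * z $ 3" using quadric by metis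
      then have "z = z $ 3 *s line u 1 \<or> z = z $ 3 *s line v 1"
        using z scale by metis
      moreover from this z have "z $ 3 \<noteq> 0" by auto
      ultimately show "\<exists>c. c \<noteq> 0 \<and> (z = c *s line u 1 \<or> z = c *s line v 1)" by blast
    next
      assume "\<exists>c. c \<noteq> 0 \<and> (z = c *s line u 1 \<or> z = c *s line v 1)"
      then obtain c w where c: "c \<noteq> 0" "w = u \<or> w = v" and z: "z = line (w * c) c"
        unfolding scale by blast
      have "z $ 3 = c" "z $ 2 = w * c" by (simp_all add: z line_def)
      with c z show "z \<noteq> 0 \<and> on_quadric sec z \<and> z = line (z $ 2) (z $ 3)"
        using quadric by auto
    qed
    then show "z \<noteq> 0 \<and> on_quadric sec z \<and> (\<Sum>k\<in>UNIV. z $ k * x k) = 0 \<and> (\<Sum>k\<in>UNIV. z $ k * y k) = 0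
      \<longleftrightarrow> (\<exists>c. c \<noteq> 0 \<and> (z = c *s line u 1 \<or> z = c *s line v 1))"
      unfolding on_line .
  qed
qed

text \<open>Inverses of the matrices of the net \<open>range A\<close> are, up to scalars, quadratic in the
  parameters. The matrices \<open>N\<close> span the space of these quadratic expressions, and \<open>D\<close>
  is a dual family, making the combination of \<open>N\<close> with coefficients \<open>x\<close> injective in \<open>x\<close>.\<close>

locale quadric_net =
  fixes sec :: bool and A :: "complex^3 \<Rightarrow> complex^3^3" and N D :: "(complex^3^3)^4"
  assumes A_add: "A (v + t *s w) = A v + cscale t (A w)"
    and A_regular: "\<exists>w. det (A w) \<noteq> 0"
    and A_mult: "det (A v) \<noteq> 0 \<Longrightarrow>
      \<exists>c. c \<noteq> 0 \<and> A v ** combination N (veronese_coords sec (veronese_map v)) = cscale c (mat 1)"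
    and N_Sym3: "N $ k \<in> Sym3"
    and D_Sym3: "D $ k \<in> Sym3"
    and dual: "linear_form (D $ k) (N $ l) = (if k = l then 1 else 0)"
begin

section \<open>Reciprocal surface of a parametrised net\<close>

definition "K = combination N"

definition "T M = K (veronese_coords sec M)"

abbreviation "X \<equiv> reciprocal_surface (range A)"

text \<open>The dual family reads off coordinates by linear forms, so conditions on \<open>x\<close>
  become polynomial conditions on the matrix \<open>K x\<close>.\<close>

lemma K_coords: "linear_form (D $ k) (K x) = x $ k"
  by (simp add: K_def linear_form_combination dual if_distrib[of "(*) _"] cong: if_cong)

lemma K_Sym3: "K x \<in> Sym3"
  using N_Sym3 by (simp add: K_def Sym3_iff combination_nth)

lemma K_inj: "K x = K y \<longleftrightarrow> x = y"
  by (metis K_coords vec_eq_iff)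

lemma K_scale: "K (c *s x) = cscale c (K x)"
  by (simp add: K_def combination_scale)

lemma K_zero: "K x = 0 \<longleftrightarrow> x = 0"
  using K_inj[of x 0] K_scale[of 0 0] by simp

lemma T_linear: "Vector_Spaces.linear cscale cscale T"
  unfolding Vector_Spaces.linear_iff T_def K_def veronese_coords_add combination_add
    veronese_coords_scale combination_scale
  using cmat.vector_space_axioms by blast

lemma T_scale: "T (cscale c M) = cscale c (T M)"
  by (simp add: T_def veronese_coords_scale K_scale)

lemma T_zero_iff: "M \<in> Sym3 \<Longrightarrow> T M = 0 \<longleftrightarrow> M \<in> center_space sec"
  by (simp add: T_def K_zero veronese_coords_zero_iff)

text \<open>\<open>A_mult\<close> makes \<open>T (veronese_map v)\<close> a nonzero multiple of the
  inverse of \<open>A v\<close>, hence a representative of the same projective point.\<close>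

lemma matrix_inv_A:
  assumes "det (A v) \<noteq> 0"
  shows "matrix_inv (A v) \<noteq> 0" "proj_point (matrix_inv (A v)) = proj_point (T (veronese_map v))"
    "T (veronese_map v) \<noteq> 0"
proof -
  obtain c where c: "c \<noteq> 0" "A v ** T (veronese_map v) = cscale c (mat 1)"
    using A_mult[OF assms] by (auto simp: T_def K_def)
  have inv: "matrix_inv (A v) = cscale (1 / c) (T (veronese_map v))"
    using c by (rule matrix_inv_of_scalar_product[rotated])
  show "T (veronese_map v) \<noteq> 0"
  proof
    assume "T (veronese_map v) = 0"
    with c(2) have "cscale c (mat 1) $ 1 $ 1 = 0"
      by (metis matrix_vector_mul_lid times0_right zero_index)
    with c(1) show False by (simp add: mat_def)
  qed
  then show "matrix_inv (A v) \<noteq> 0" "proj_point (matrix_inv (A v)) = proj_point (T (veronese_map v))"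
    using c(1) by (simp_all add: inv proj_point_cscale)
qed

definition "inverse_points = Proj {matrix_inv B |B. B \<in> range A \<and> det B \<noteq> 0}"

lemma inverse_points_eq:
  "inverse_points = {proj_point (T (veronese_map v)) |v. det (A v) \<noteq> 0}"
proof -
  show ?thesis
    unfolding inverse_points_def Proj_def using matrix_inv_A(1,2) by (auto simp: image_iff; force)
qed

lemma X_eq_closure: "X = zariski_closure inverse_points"
  by (simp add: reciprocal_surface_def inverse_points_def)

text \<open>Regular parameters are dense: moving from \<open>v\<close> in a direction
  \<open>w\<close> with \<open>A w\<close> invertible gives invertible matrices for all small
  nonzero t, and continuity leads back to \<open>v\<close>.\<close>

lemma vanishes_on_inverse_points:
  assumes f: "f \<in> homogeneous_polys d"
  shows "vanishes_on f inverse_points \<longleftrightarrow> (\<forall>v. f (T (veronese_map v)) = 0)"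
proof
  assume "vanishes_on f inverse_points"
  then have regular: "f (T (veronese_map v)) = 0" if "det (A v) \<noteq> 0" for v
    using that self_in_proj_point unfolding vanishes_on_def inverse_points_eq by blast
  show "\<forall>v. f (T (veronese_map v)) = 0"
  proof
    fix v
    obtain w where "det (A w) \<noteq> 0" using A_regular by blast
    then have "\<forall>\<^sub>F t in at 0. det (A (v + t *s w)) \<noteq> 0"
      unfolding A_add by (rule eventually_det_pencil_nonzero)
    then have "\<forall>\<^sub>F t in at 0. f (T (veronese_map (v + t *s w))) = 0"
      by eventually_elim (rule regular)
    moreover have "isCont (\<lambda>t. T (veronese_map (v + t *s w)) $ i $ j) 0" for i j
      unfolding T_def K_def combination_nth sum_4 veronese_coords_veronese
      by (cases sec) (auto intro!: continuous_intros)
    ultimately have "f (T (veronese_map (v + 0 *s w))) = 0"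
      by (intro entry_poly_zero_limit[OF homogeneous_polysD(1)[OF f],
            where \<gamma> = "\<lambda>t. T (veronese_map (v + t *s w))"])
    then show "f (T (veronese_map v)) = 0" by simp
  qed
next
  assume "\<forall>v. f (T (veronese_map v)) = 0"
  then show "vanishes_on f inverse_points"
    unfolding inverse_points_eq vanishes_on_def
    by (auto simp: proj_point_eq_range homogeneous_polysD(2)[OF f])
qed

text \<open>Off x3 = 0 the quadric is parametrised by the Veronese map, and the remaining points are
  limits of such points.\<close>

lemma vanishes_on_quadric:
  assumes f: "f \<in> homogeneous_polys d" "\<forall>v. f (T (veronese_map v)) = 0" and x: "on_quadric sec x"
  shows "f (K x) = 0"
proof -
  obtain \<gamma> where \<gamma>: "\<gamma> (0 :: complex) = x" "\<And>k. isCont (\<lambda>t. \<gamma> t $ k) 0"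
    "\<And>t. t \<noteq> 0 \<Longrightarrow> on_quadric sec (\<gamma> t) \<and> \<gamma> t $ 3 \<noteq> (0 :: complex)"
    using on_quadric_perturb[OF x] by blast
  have "f (K (\<gamma> t)) = 0" if "t \<noteq> 0" for t
    using on_quadric_affine \<gamma>(3)[OF that] f(2) by (metis T_def)
  then have "\<forall>\<^sub>F t in at 0. f (K (\<gamma> t)) = 0"
    by (auto simp: eventually_at_filter)
  moreover have "isCont (\<lambda>t. K (\<gamma> t) $ i $ j) 0" for i j
    by (auto simp: K_def combination_nth intro!: continuous_intros \<gamma>(2))
  ultimately have "f (K (\<gamma> 0)) = 0"
    by (intro entry_poly_zero_limit[OF homogeneous_polysD(1)[OF f(1)], where \<gamma> = "\<lambda>t. K (\<gamma> t)"])
  then show ?thesis by (simp add: \<gamma>(1))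
qed

text \<open>Linear equations of the image of \<open>K\<close>: a matrix lies there exactly if its
  dual coordinates rebuild it.\<close>

lemma K_recover_homogeneous:
  "(\<lambda>M. M $ i $ j - (\<Sum>k\<in>UNIV. linear_form (D $ k) M * N $ k $ i $ j)) \<in> homogeneous_polys 1"
proof -
  have "(\<lambda>M. M $ i $ j - (\<Sum>k\<in>UNIV. linear_form (D $ k) M * N $ k $ i $ j)) \<in> entry_polys"
    by (intro poly_functions_intros entry_poly linear_form_poly)
  then show ?thesis
    by (simp add: homogeneous_polys_def linear_form_cscale sum_distrib_left algebra_simps)
qed

text \<open>The equation of the quadric, pulled back through the dual forms; together with the
  linear equations above it cuts out the reciprocal surface.\<close>

lemma quadric_homogeneous:
  "(\<lambda>M. (if sec then linear_form (D $ 1) M else linear_form (D $ 2) M) * linear_form (D $ 2) M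
     - linear_form (D $ 3) M * linear_form (D $ 4) M) \<in> homogeneous_polys 2"
proof -
  have "(\<lambda>M. linear_form B M * linear_form (D $ 2) M
     - linear_form (D $ 3) M * linear_form (D $ 4) M) \<in> entry_polys" for B
    by (intro poly_functions_intros linear_form_poly)
  then show ?thesis
    by (cases sec) (simp_all add: homogeneous_polys_def linear_form_cscale power2_eq_square algebra_simps)
qed

text \<open>One inclusion tests the closure against the linear and quadratic equations above; for
  the other, every form vanishing on the inverses vanishes on the whole quadric.\<close>

lemma X_eq_quadric: "X = {proj_point (K x) |x. x \<noteq> 0 \<and> on_quadric sec x}"
proof (intro equalityI subsetI)
  fix p assume p: "p \<in> X"
  then obtain M where M: "M \<in> Sym3" "M \<noteq> 0" "p = proj_point M"
    by (auto simp: X_eq_closure zariski_closure_def Proj_def)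
  have vanish: "f M = 0" if f: "f \<in> homogeneous_polys d" "\<And>v. f (T (veronese_map v)) = 0" for f d
    using p that unfolding X_eq_closure zariski_closure_def
    by (auto simp: M(3) vanishes_on_inverse_points vanishes_on_point)
  define x where "x = (\<chi> k. linear_form (D $ k) M)"
  have "M $ i $ j - (\<Sum>k\<in>UNIV. linear_form (D $ k) M * N $ k $ i $ j) = 0" for i j
    by (rule vanish[OF K_recover_homogeneous])
       (simp add: T_def K_coords, simp add: K_def combination_nth)
  then have Kx: "M = K x"
    by (simp add: matrix_eq_iff_3 K_def combination_nth x_def)
  have "(if sec then linear_form (D $ 1) M else linear_form (D $ 2) M) * linear_form (D $ 2) M
     - linear_form (D $ 3) M * linear_form (D $ 4) M = 0"
    by (rule vanish[OF quadric_homogeneous])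
       (unfold T_def K_coords veronese_coords_veronese, simp)
  then have "on_quadric sec x"
    by (simp add: on_quadric_def x_def split: if_splits)
  with Kx M show "p \<in> {proj_point (K x) |x. x \<noteq> 0 \<and> on_quadric sec x}"
    using K_zero by blast
next
  fix p assume "p \<in> {proj_point (K x) |x. x \<noteq> 0 \<and> on_quadric sec x}"
  then obtain x where x: "p = proj_point (K x)" "x \<noteq> 0" "on_quadric sec x" by blast
  have "p \<in> P5"
    unfolding Proj_def x(1) using x(2) K_zero K_Sym3 by blast
  then show "p \<in> X"
    unfolding X_eq_closure zariski_closure_def x(1)
    by (auto simp: vanishes_on_inverse_points vanishes_on_point vanishes_on_quadric[OF _ _ x(3)])
qed

text \<open>The projected Veronese points may also come from \<open>v\<close> with
  \<open>A v\<close> singular. The same homogeneous polynomials vanish on them as on the inverses,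
  so the closures agree.\<close>

lemma projection_X: "projection_of_Veronese_from X (Proj (center_space sec))"
proof -
  define Y where "Y = (\<lambda>p. T ` p) ` (Veronese - Proj (center_space sec))"
  have T_point: "T ` proj_point M = proj_point (T M)" for M
    by (auto simp: proj_point_eq_range image_image T_scale)
  have "Y = {proj_point (T (veronese_map v)) |v. T (veronese_map v) \<noteq> 0}"
  proof (intro equalityI subsetI)
    fix q assume "q \<in> Y"
    then obtain v where v: "q = proj_point (T (veronese_map v))" "v \<noteq> 0"
        "proj_point (veronese_map v) \<notin> Proj (center_space sec)"
      by (auto simp: Y_def Veronese_def T_point)
    then have "veronese_map v \<notin> center_space sec"
      by (auto simp: Proj_def veronese_map_zero_iff)
    then show "q \<in> {proj_point (T (veronese_map v)) |v. T (veronese_map v) \<noteq> 0}"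
      using v(1) T_zero_iff veronese_map_Sym3 by blast
  next
    fix q assume "q \<in> {proj_point (T (veronese_map v)) |v. T (veronese_map v) \<noteq> 0}"
    then obtain v where v: "q = T ` proj_point (veronese_map v)" "T (veronese_map v) \<noteq> 0"
      by (auto simp: T_point)
    have "proj_point (veronese_map v) \<notin> Proj (center_space sec)"
    proof
      assume "proj_point (veronese_map v) \<in> Proj (center_space sec)"
      then obtain M where "M \<in> center_space sec" "proj_point (veronese_map v) = proj_point M"
        by (auto simp: Proj_def)
      then have "T M = 0" "\<exists>c. veronese_map v = cscale c M"
        using T_zero_iff center_space_iff proj_point_eqD by blast+
      with v(2) show False by (auto simp: T_scale)
    qed
    moreover have "v \<noteq> 0"
      using v(2) T_scale[of 0 0] by (auto simp: veronese_map_zero_iff[THEN iffD2])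
    ultimately show "q \<in> Y"
      by (auto simp: Y_def Veronese_def v(1))
  qed
  then have "vanishes_on f Y \<longleftrightarrow> vanishes_on f inverse_points" if f: "f \<in> homogeneous_polys d" for f d
  proof -
    assume Y: "Y = {proj_point (T (veronese_map v)) |v. T (veronese_map v) \<noteq> 0}"
    have "inverse_points \<subseteq> Y"
      unfolding Y inverse_points_eq using matrix_inv_A(3) by blast
    moreover have "vanishes_on f Y" if "vanishes_on f inverse_points"
      using that f unfolding vanishes_on_inverse_points[OF f] unfolding Y vanishes_on_def
      by (auto simp: proj_point_eq_range homogeneous_polysD(2)[OF f])
    ultimately show ?thesis
      unfolding vanishes_on_def by blast
  qed
  then have "X = zariski_closure Y"
    unfolding X_eq_closure zariski_closure_def by auto
  moreover have "{M \<in> Sym3. T M = 0} = center_space sec"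
    using T_zero_iff center_space_iff by blast
  moreover have "T ` Sym3 \<subseteq> Sym3"
    using K_Sym3 by (auto simp: T_def)
  ultimately show ?thesis
    unfolding projection_of_Veronese_from_def Y_def by (intro exI[of _ T] conjI T_linear) simp_all
qed

text \<open>A section of codimension two pulls back along \<open>K\<close> to a line section of a
  quadric in projective three-space, which is general when \<open>section_discriminant\<close> is
  nonzero.\<close>

lemma X_degree: "surface_degree X 2"
proof -
  define x where "x B k = linear_form B (N $ k)" for B k
  define q where "q = (\<lambda>(B1, B2). section_discriminant sec (x B1) (x B2))"
  have K_form: "linear_form B (K z) = (\<Sum>k\<in>UNIV. z $ k * x B k)" for B z
    by (simp add: K_def linear_form_combination x_def)
  have fst_poly: "(\<lambda>p. x (fst p) k) \<in> pair_polys" and snd_poly: "(\<lambda>p. x (snd p) k) \<in> pair_polys" for k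
  proof -
    have "(\<lambda>p. fst p $ i $ j) \<in> pair_polys" "(\<lambda>p. snd p $ i $ j) \<in> pair_polys" for i j
      unfolding pair_polys_def by (rule poly_functions.coord; force simp: case_prod_beta')+
    then show "(\<lambda>p. x (fst p) k) \<in> pair_polys" "(\<lambda>p. x (snd p) k) \<in> pair_polys"
      unfolding x_def linear_form_def pair_polys_def by (auto intro!: poly_functions_intros)
  qed
  have "q \<in> pair_polys"
    unfolding q_def case_prod_beta' section_discriminant_def Let_def
    using fst_poly snd_poly unfolding pair_polys_def
    by (cases sec) (auto intro!: poly_functions_intros)
  moreover have "\<exists>B1\<in>Sym3. \<exists>B2\<in>Sym3. q (B1, B2) \<noteq> 0"
  proof -
    \<comment> \<open>The section by \<open>x$1 = x$2\<close> and \<open>x$3 = x$4\<close>.\<close>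
    have "x (D $ k - D $ l) m = (if k = m then 1 else 0) - (if l = m then 1 else 0)" for k l m
    proof -
      have "x (D $ k - D $ l) m = x (D $ k) m - x (D $ l) m"
        by (simp add: x_def linear_form_def algebra_simps sum_subtractf)
      then show ?thesis by (simp add: x_def dual)
    qed
    then have "q (D $ 1 - D $ 2, D $ 4 - D $ 3) \<noteq> 0"
      by (cases sec) (simp_all add: q_def section_discriminant_def)
    moreover have "D $ k - D $ l \<in> Sym3" for k l
      using D_Sym3 by (simp add: Sym3_iff)
    ultimately show ?thesis by blast
  qed
  moreover have "finite S \<and> card S = 2"
    if "q (B1, B2) \<noteq> 0"
      and S: "S = {p \<in> X. vanishes_on (linear_form B1) {p} \<and> vanishes_on (linear_form B2) {p}}" for B1 B2 S
  proof -
    have "section_discriminant sec (x B1) (x B2) \<noteq> 0"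
      using that(1) by (simp add: q_def)
    then obtain z1 z2 where z: "z1 $ 3 = 1" "z2 $ 3 = 1" "z1 \<noteq> z2"
      and sol: "\<And>z. z \<noteq> 0 \<and> on_quadric sec z \<and> (\<Sum>k\<in>UNIV. z $ k * x B1 k) = 0 \<and>
            (\<Sum>k\<in>UNIV. z $ k * x B2 k) = 0 \<longleftrightarrow> (\<exists>c. c \<noteq> 0 \<and> (z = c *s z1 \<or> z = c *s z2))"
      by (rule quadric_line_section) (rule that)
    have "S = {proj_point (K z) |z. z \<noteq> 0 \<and> on_quadric sec z \<and> (\<Sum>k\<in>UNIV. z $ k * x B1 k) = 0 \<and>
            (\<Sum>k\<in>UNIV. z $ k * x B2 k) = 0}"
      unfolding S X_eq_quadric by (auto simp: vanishes_on_linear_form K_form)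
    also have "\<dots> = {proj_point (K z1), proj_point (K z2)}"
      unfolding sol by (auto simp: K_scale proj_point_cscale intro: exI[of _ z1] exI[of _ z2])
        (metis vector_smult_lid zero_neq_one)+
    finally have S2: "S = {proj_point (K z1), proj_point (K z2)}" .
    \<comment> \<open>Both solutions have third coordinate 1, so proportional ones would
      coincide.\<close>
    have "proj_point (K z1) \<noteq> proj_point (K z2)"
    proof
      assume "proj_point (K z1) = proj_point (K z2)"
      then obtain c where "K z1 = cscale c (K z2)" using proj_point_eqD by blast
      then have "z1 = c *s z2" by (simp add: K_inj flip: K_scale)
      with z show False by auto
    qed
    with S2 show ?thesis by simp
  qed
  ultimately show ?thesis
    unfolding surface_degree_def Let_def by blast
qed

end

section \<open>The four types\<close>

text \<open>\<open>linear_form\<close> is the trace pairing, so a congruence of \<open>M\<close>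
  moves to the adjoint congruence of \<open>B\<close>.\<close>

lemma linear_form_congruence:
  "linear_form B (h ** M ** transpose h) = linear_form (transpose h ** B ** h) M"
  by (simp add: linear_form_def matrix_matrix_mult_def transpose_def sum_3 algebra_simps)

lemma combination_congruence:
  "combination (\<chi> k. h ** N $ k ** transpose h) x = h ** combination N x ** transpose h"
  by (simp add: matrix_eq_iff_3 combination_nth matrix_matrix_mult_def sum_4 sum_3 algebra_simps)

lemma matrix_mult_cscale: "A ** cscale c B = cscale c (A ** B)" "cscale c A ** B = cscale c (A ** B)"
  by (simp_all add: matrix_eq_iff_3 matrix_matrix_mult_def sum_distrib_left mult_ac)

lemma matrix_add_rdistrib: "(A + B) ** C = A ** C + B ** C"
  for A B :: "'a::semiring_1^'n^'m" and C :: "'a^'k^'n"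
  by (simp add: vec_eq_iff matrix_matrix_mult_def sum.distrib algebra_simps)

lemma Sym3_congruence: "M \<in> Sym3 \<Longrightarrow> transpose h ** M ** h \<in> Sym3"
  by (simp add: Sym3_def matrix_transpose_mul matrix_mul_assoc)

text \<open>With \<open>h\<close> inverse to \<open>g\<close>, inverses change by \<open>h\<close>
  on the left and its transpose on the right. So \<open>N\<close> transforms by \<open>h\<close>,
  and the dual family by \<open>g\<close> to preserve the pairing.\<close>

lemma quadric_net_congruence:
  assumes "quadric_net sec A N D" "invertible g"
  obtains N' D' where "quadric_net sec (\<lambda>v. transpose g ** A v ** g) N' D'"
proof -
  interpret quadric_net sec A N D by fact
  obtain h where h: "g ** h = mat 1" "h ** g = mat 1"
    using assms(2) by (auto simp: invertible_def)
  have th: "transpose h ** transpose g = mat 1" "transpose g ** transpose h = mat 1"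
    using h by (metis matrix_transpose_mul transpose_mat)+
  have det: "det (transpose g ** A v ** g) \<noteq> 0 \<longleftrightarrow> det (A v) \<noteq> 0" for v
    using assms(2) by (simp add: det_mul invertible_det_nz)
  have "quadric_net sec (\<lambda>v. transpose g ** A v ** g)
      (\<chi> k. h ** N $ k ** transpose h) (\<chi> k. transpose g ** D $ k ** g)"
  proof
    show "transpose g ** A (v + t *s w) ** g =
        transpose g ** A v ** g + cscale t (transpose g ** A w ** g)" for v t w
      by (simp add: A_add matrix_add_ldistrib matrix_add_rdistrib matrix_mult_cscale)
    show "\<exists>w. det (transpose g ** A w ** g) \<noteq> 0"
      unfolding det by (rule A_regular)
    show "\<exists>c. c \<noteq> 0 \<and> (transpose g ** A v ** g) **
        combination (\<chi> k. h ** N $ k ** transpose h) (veronese_coords sec (veronese_map v)) = cscale c (mat 1)"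
      if nz: "det (transpose g ** A v ** g) \<noteq> 0" for v
    proof -
      let ?C = "combination N (veronese_coords sec (veronese_map v))"
      obtain c where c: "c \<noteq> 0" "A v ** ?C = cscale c (mat 1)"
        using A_mult nz unfolding det by blast
      have "(transpose g ** A v ** g) ** (h ** ?C ** transpose h)
          = transpose g ** (A v ** (g ** h) ** ?C) ** transpose h"
        by (simp only: matrix_mul_assoc)
      also have "\<dots> = cscale c (mat 1)"
        by (simp add: h c(2) matrix_mult_cscale th)
      finally show ?thesis
        using c(1) unfolding combination_congruence by blast
    qed
    show "(\<chi> k. h ** N $ k ** transpose h) $ k \<in> Sym3" for k
      using Sym3_congruence[OF N_Sym3, of "transpose h"] by simp
    show "(\<chi> k. transpose g ** D $ k ** g) $ k \<in> Sym3" for k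
      using Sym3_congruence[OF D_Sym3] by simp
    show "linear_form ((\<chi> k. transpose g ** D $ k ** g) $ k) ((\<chi> k. h ** N $ k ** transpose h) $ l)
        = (if k = l then 1 else 0)" for k l
    proof -
      have "transpose h ** (transpose g ** D $ k ** g) ** h
          = (transpose h ** transpose g) ** D $ k ** (g ** h)"
        by (simp only: matrix_mul_assoc)
      then show ?thesis
        by (simp add: linear_form_congruence h th dual)
    qed
  qed
  then show thesis by (rule that)
qed

text \<open>The center does not move because the projected Veronese surface is that of the parameter
  vectors; congruence changes only the target matrices \<open>N\<close>.\<close>

lemma congruent_quadric_net:
  assumes "quadric_net sec A N D" "congruent_nets (range A) L"
  shows "surface_degree (reciprocal_surface L) 2"
    "projection_of_Veronese_from (reciprocal_surface L) (Proj (center_space sec))"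
proof -
  obtain g where g: "invertible g" "L = range (\<lambda>v. transpose g ** A v ** g)"
    using assms(2) by (auto simp: congruent_nets_def image_image)
  obtain N' D' where "quadric_net sec (\<lambda>v. transpose g ** A v ** g) N' D'"
    using quadric_net_congruence[OF assms(1) g(1)] by blast
  then interpret quadric_net sec "\<lambda>v. transpose g ** A v ** g" N' D' .
  show "surface_degree (reciprocal_surface L) 2"
    "projection_of_Veronese_from (reciprocal_surface L) (Proj (center_space sec))"
    unfolding g(2) by (rule X_degree, rule projection_X)
qed

section \<open>Parametrisations and adjugates of the four nets\<close>

definition "param_D v = conic (v $ 1) (v $ 2) (v $ 3) (v $ 3) 0 0" for v :: "complex^3"
definition "param_F v = conic (v $ 1) (v $ 2) 0 0 (v $ 3) (v $ 3)" for v :: "complex^3"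
definition "param_Fstar v = conic (v $ 1) (v $ 3) (v $ 3) (v $ 2) 0 0" for v :: "complex^3"
definition "param_Gstar v = conic (v $ 1) 0 0 (v $ 2) 0 (v $ 3)" for v :: "complex^3"

lemma range_vec3: "range (\<lambda>v :: complex^3. f (v $ 1) (v $ 2) (v $ 3)) = {f a b c |a b c. True}"
  for f :: "complex \<Rightarrow> complex \<Rightarrow> complex \<Rightarrow> 'a"
proof (intro equalityI subsetI)
  fix y assume "y \<in> {f a b c |a b c. True}"
  then obtain a b c where "y = f (vec3 a b c $ 1) (vec3 a b c $ 2) (vec3 a b c $ 3)" by auto
  then show "y \<in> range (\<lambda>v :: complex^3. f (v $ 1) (v $ 2) (v $ 3))" by blast
qed auto

lemma net_D_param: "net_D = range param_D"
  unfolding param_D_def range_vec3[of "\<lambda>a b c. conic a b c c 0 0"] by (simp add: net_D_def span_triple)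

lemma net_F_param: "net_F = range param_F"
  unfolding param_F_def range_vec3[of "\<lambda>a b c. conic a b 0 0 c c"] by (simp add: net_F_def span_triple)

lemma net_Fstar_param: "net_Fstar = range param_Fstar"
  unfolding param_Fstar_def range_vec3[of "\<lambda>a b c. conic a c c b 0 0"]
  by (simp add: net_Fstar_def span_triple)

lemma net_Gstar_param: "net_Gstar = range param_Gstar"
  unfolding param_Gstar_def range_vec3[of "\<lambda>a b c. conic a 0 0 b 0 c"]
  by (simp add: net_Gstar_def span_triple)

text \<open>The nonzero scalar demanded by \<open>A_mult\<close> is the determinant, as in the
  adjugate identity.\<close>

lemma quadric_net_from_adjugate:
  assumes "\<And>v t w. A (v + t *s w) = A v + cscale t (A w)"
    and "\<exists>w. det (A w) \<noteq> 0"
    and "\<And>v. A v ** combination N (veronese_coords sec (veronese_map v)) = cscale (det (A v)) (mat 1)"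
    and "\<forall>k. N $ k \<in> Sym3" "\<forall>k. D $ k \<in> Sym3"
    and "\<forall>k l. linear_form (D $ k) (N $ l) = (if k = l then 1 else 0)"
  shows "quadric_net sec A N D"
  using assms by unfold_locales auto

lemmas adjugate_simps = vec_eq_iff forall_3 matrix_matrix_mult_def sum_3 sum_4 det_3 mat_def
  combination_nth veronese_coords_veronese algebra_simps

text \<open>In each case the third argument of \<open>quadric_net\<close> is read off from the adjugate of the
  parametrised matrix.\<close>

lemma quadric_net_D: "quadric_net True param_D
  (vector [conic 0 1 0 0 0 0, conic 1 0 0 0 0 0, conic 0 0 (-1) (-1) 0 0, conic 0 0 1 0 0 0])
  (vector [conic 0 1 0 0 0 0, conic 1 0 0 0 0 0, conic 0 0 0 (-1/2) 0 0, conic 0 0 1 (-1/2) 0 0])"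
proof (rule quadric_net_from_adjugate)
  show "\<exists>w. det (param_D w) \<noteq> 0"
    \<comment> \<open>The determinant is c (ab - c^2), which would vanish at a = b = c = 1.\<close>
    by (rule exI[of _ "vec3 1 1 2"]) (simp add: param_D_def det_3)
qed (simp_all add: param_D_def adjugate_simps forall_4 linear_form_def)

text \<open>The halves in the dual family arise because \<open>linear_form\<close> counts each
  off-diagonal entry twice.\<close>

lemma quadric_net_F: "quadric_net True param_F
  (vector [conic 0 0 0 0 0 (-1), conic 0 0 0 0 (-1) 0, conic (-1) (-1) 0 1 0 0, conic 0 0 1 0 0 0])
  (vector [conic 0 0 0 0 0 (-1/2), conic 0 0 0 0 (-1/2) 0, conic (-1) 0 0 0 0 0, conic 0 0 1 0 0 0])"
proof (rule quadric_net_from_adjugate)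
  show "\<exists>w. det (param_F w) \<noteq> 0"
    by (rule exI[of _ "vec3 1 1 1"]) (simp add: param_F_def det_3)
qed (simp_all add: param_F_def adjugate_simps forall_4 linear_form_def)

text \<open>The adjugate has the diagonal entries ac and ac - b^2; the last dual matrix takes their
  difference to isolate b^2.\<close>

lemma quadric_net_Fstar: "quadric_net False param_Fstar
  (vector [conic 0 1 1 0 0 0, conic 0 0 0 (-1) 0 0, conic 1 0 0 0 0 0, conic 0 0 (-1) 0 0 0])
  (vector [conic 0 1 0 0 0 0, conic 0 0 0 (-1/2) 0 0, conic 1 0 0 0 0 0, conic 0 1 (-1) 0 0 0])"
proof (rule quadric_net_from_adjugate)
  show "\<exists>w. det (param_Fstar w) \<noteq> 0"
    by (rule exI[of _ "vec3 1 0 1"]) (simp add: param_Fstar_def det_3)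
qed (simp_all add: param_Fstar_def adjugate_simps forall_4 linear_form_def)

lemma quadric_net_Gstar: "quadric_net False param_Gstar
  (vector [conic 0 0 0 0 0 (-1), conic 0 0 0 0 1 0, conic (-1) 0 0 0 0 0, conic 0 0 (-1) 0 0 0])
  (vector [conic 0 0 0 0 0 (-1/2), conic 0 0 0 0 (1/2) 0, conic (-1) 0 0 0 0 0, conic 0 0 (-1) 0 0 0])"
proof (rule quadric_net_from_adjugate)
  show "\<exists>w. det (param_Gstar w) \<noteq> 0"
    by (rule exI[of _ "vec3 1 0 1"]) (simp add: param_Gstar_def det_3)
qed (simp_all add: param_Gstar_def adjugate_simps forall_4 linear_form_def)

theorem proposition3p6:
  fixes L :: "(complex^3^3) set"
  assumes "is_net L"
    and "congruent_nets net_D L \<or> congruent_nets net_F L \<or>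
         congruent_nets net_Fstar L \<or> congruent_nets net_Gstar L"
  shows "surface_degree (reciprocal_surface L) 2 \<and>
    (\<exists>E. proj_line E \<and> projection_of_Veronese_from (reciprocal_surface L) E) \<and>
    (congruent_nets net_D L \<or> congruent_nets net_F L \<longrightarrow>
      (\<exists>E. proj_line E \<and> projection_of_Veronese_from (reciprocal_surface L) E \<and>
           secant_line Veronese E)) \<and>
    (congruent_nets net_Fstar L \<or> congruent_nets net_Gstar L \<longrightarrow>
      (\<exists>E. proj_line E \<and> projection_of_Veronese_from (reciprocal_surface L) E \<and>
           tangent_line Veronese E))"
proof -
  let ?R = "reciprocal_surface L"
  let ?P = "\<lambda>sec. surface_degree ?R 2 \<and> projection_of_Veronese_from ?R (Proj (center_space sec))"
  have sec: "?P True" if "congruent_nets net_D L \<or> congruent_nets net_F L"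
    using that congruent_quadric_net[OF quadric_net_D] congruent_quadric_net[OF quadric_net_F]
    unfolding net_D_param net_F_param by blast
  have tan: "?P False" if "congruent_nets net_Fstar L \<or> congruent_nets net_Gstar L"
    using that congruent_quadric_net[OF quadric_net_Fstar] congruent_quadric_net[OF quadric_net_Gstar]
    unfolding net_Fstar_param net_Gstar_param by blast
  show ?thesis
    using assms(2) sec tan proj_line_center secant_line_center tangent_line_center by blast
qed

end
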